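(* For every integer $r \geq 1$, the $(2r+2)\times(2r+2)$ $0,1$-matrix $M = \begin{pmatrix} A & B \\ J & A^{\dagger}\end{pmatrix}$ is primitive with exponent $3$, and the level poset associated to $M$ is Eulerian.
   Context: Blocks (all $(r+1)\times(r+1)$, indexed by $0\le i,j\le r$): $A=(a_{i,j})$ with $a_{i,j}=1$ if $i=0$ and $0$ otherwise; $B=(b_{i,j})$ with $b_{i,j}=1$ if $0\le i-j\le 1$ and $0$ otherwise; $J$ is the all-ones matrix; $A^{\dagger}$ is the reflection of $A$ over its anti-diagonal, i.e. $(A^{\dagger})_{i,j}=a_{r-j,r-i}$, so $(A^{\dagger})_{i,j}=1$ if $j=r$ and $0$ otherwise. For a non-negative matrix $X$, $\mathrm{Bin}(X)$ is the $0,1$-matrix with entry $1$ exactly where the entry of $X$ is positive. A non-negative square matrix $X$ is primitive if there is a positive integer $k$ such that all entries of $\mathrm{Bin}(X^k)$ equal $1$; the smallest such $k$ is the exponent of $X$. The level poset associated to an $n\times n$ $0,1$-matrix $X=(x_{i,j})$ is the ranked poset on (index set of size $n$) $\times\mathbb{Z}$ whose cover relations are $(i,s)\prec(j,s+1)$ if and only if $x_{i,j}=1$; the rank of $(i,s)$ is $s$. Equivalently $(i,s)\le(j,p)$ if and only if $p \geq s$ and $\mathrm{Bin}(X^{p-s})_{i,j}=1$, with $X^0$ the identity matrix. A ranked poset is Eulerian if every non-singleton interval $[x,y]=\{z: x\le z\le y\}$ has as many elements of even rank as of odd rank. *)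

theory Defs
  imports "Jordan_Normal_Form.Matrix"
begin

definition block_A :: "nat \<Rightarrow> real mat" where
  "block_A r = mat (r + 1) (r + 1) (\<lambda>(i, j). if i = 0 then 1 else 0)"

(* The condition 0 <= i - j <= 1 is written without the truncated subtraction on nat. *)
definition block_B :: "nat \<Rightarrow> real mat" where
  "block_B r = mat (r + 1) (r + 1) (\<lambda>(i, j). if j \<le> i \<and> i \<le> j + 1 then 1 else 0)"

definition block_J :: "nat \<Rightarrow> real mat" where
  "block_J r = mat (r + 1) (r + 1) (\<lambda>(i, j). 1)"

(* For an (r+1) x (r+1) matrix the entry at (i, j) is X $$ (r - j, r - i);
   the subtractions do not truncate within the index range. *)
definition antidiag_reflection :: "'a mat \<Rightarrow> 'a mat" where
  "antidiag_reflection X = mat (dim_col X) (dim_row X)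
     (\<lambda>(i, j). X $$ (dim_row X - 1 - j, dim_col X - 1 - i))"

definition block_matrix :: "nat \<Rightarrow> real mat" where
  "block_matrix r = four_block_mat
     (block_A r) (block_B r)
     (block_J r) (antidiag_reflection (block_A r))"

lemma block_matrix_carrier: "block_matrix r \<in> carrier_mat (2 * r + 2) (2 * r + 2)"
  by (rule carrier_matI) (simp_all add: block_matrix_def block_A_def antidiag_reflection_def)

lemma antidiag_reflection_block_A:
  "antidiag_reflection (block_A r) = mat (r + 1) (r + 1) (\<lambda>(i, j). if j = r then 1 else 0)"
proof (rule eq_matI)
  fix i j
  assume "i < dim_row (mat (r + 1) (r + 1) (\<lambda>(i, j). if j = r then 1 else 0 :: real))"
    and "j < dim_col (mat (r + 1) (r + 1) (\<lambda>(i, j). if j = r then 1 else 0 :: real))"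
  then have ij: "i < r + 1" "j < r + 1" by simp_all
  then have "r - j < r + 1" "r - i < r + 1" "r - j = 0 \<longleftrightarrow> j = r" by linarith+
  with ij show "antidiag_reflection (block_A r) $$ (i, j) =
      mat (r + 1) (r + 1) (\<lambda>(i, j). if j = r then 1 else 0) $$ (i, j)"
    by (simp only: antidiag_reflection_def block_A_def index_mat dim_row_mat dim_col_mat
        prod.case add_diff_cancel_right' if_cancel)
qed (simp_all add: antidiag_reflection_def block_A_def)

definition nonneg_matrix :: "real mat \<Rightarrow> bool" where
  "nonneg_matrix X \<longleftrightarrow> (\<forall>i < dim_row X. \<forall>j < dim_col X. X $$ (i, j) \<ge> 0)"

definition Bin :: "real mat \<Rightarrow> real mat" where
  "Bin X = map_mat (\<lambda>x. if x > 0 then 1 else 0) X"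

definition all_ones :: "real mat \<Rightarrow> bool" where
  "all_ones X \<longleftrightarrow> (\<forall>i < dim_row X. \<forall>j < dim_col X. X $$ (i, j) = 1)"

definition primitive_matrix :: "real mat \<Rightarrow> bool" where
  "primitive_matrix X \<longleftrightarrow>
     square_mat X \<and> nonneg_matrix X \<and> (\<exists>k::nat. k > 0 \<and> all_ones (Bin (X ^\<^sub>m k)))"

(* Meaningful only for primitive matrices. *)
definition matrix_exponent :: "real mat \<Rightarrow> nat" where
  "matrix_exponent X = (LEAST k. k > 0 \<and> all_ones (Bin (X ^\<^sub>m k)))"

(* Posets are given by a carrier P together with the relation r of all pairs (x, y) with x <= y. *)

definition poset_covers :: "('a \<times> 'a) set \<Rightarrow> 'a \<Rightarrow> 'a \<Rightarrow> bool" where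
  "poset_covers r x y \<longleftrightarrow>
     (x, y) \<in> r \<and> x \<noteq> y \<and> (\<forall>z. (x, z) \<in> r \<and> (z, y) \<in> r \<longrightarrow> z = x \<or> z = y)"

definition poset_interval :: "('a \<times> 'a) set \<Rightarrow> 'a \<Rightarrow> 'a \<Rightarrow> 'a set" where
  "poset_interval r x y = {z. (x, z) \<in> r \<and> (z, y) \<in> r}"

(* Ranks are integers, since level posets extend infinitely in both directions.
   Local finiteness is required so that counting the elements of an interval by card is
   meaningful (card is 0 on infinite sets) and every x < y is joined by a chain of covers. *)
definition ranked_poset :: "'a set \<Rightarrow> ('a \<times> 'a) set \<Rightarrow> ('a \<Rightarrow> int) \<Rightarrow> bool" where
  "ranked_poset P r rk \<longleftrightarrow>
     partial_order_on P r \<and>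
     (\<forall>x y. finite (poset_interval r x y)) \<and>
     (\<forall>x y. poset_covers r x y \<longrightarrow> rk y = rk x + 1)"

definition eulerian_poset :: "'a set \<Rightarrow> ('a \<times> 'a) set \<Rightarrow> ('a \<Rightarrow> int) \<Rightarrow> bool" where
  "eulerian_poset P r rk \<longleftrightarrow>
     ranked_poset P r rk \<and>
     (\<forall>x y. (x, y) \<in> r \<and> x \<noteq> y \<longrightarrow>
        card {z \<in> poset_interval r x y. even (rk z)} =
        card {z \<in> poset_interval r x y. odd (rk z)})"

definition level_carrier :: "real mat \<Rightarrow> (nat \<times> int) set" where
  "level_carrier X = {0..<dim_row X} \<times> UNIV"

definition level_cover :: "real mat \<Rightarrow> ((nat \<times> int) \<times> (nat \<times> int)) set" where
  "level_cover X =
     {((i, s), (j, s + 1)) | i j s. i < dim_row X \<and> j < dim_row X \<and> X $$ (i, j) = 1}"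

(* The order generated by the cover relations. The restriction removes the
   reflexive pairs outside the carrier, which rtrancl adds. *)
definition level_order :: "real mat \<Rightarrow> ((nat \<times> int) \<times> (nat \<times> int)) set" where
  "level_order X = (level_cover X)\<^sup>* \<inter> (level_carrier X \<times> level_carrier X)"

definition level_rank :: "nat \<times> int \<Rightarrow> int" where
  "level_rank = snd"

end

theory Submission
  imports Defs
begin

text \<open>The powers of \<open>M\<close> with exponent at least \<open>3\<close> are entrywise positive, and the zeros of \<open>M\<close> and
  \<open>M\<^sup>2\<close> are explicit. In an interval of length \<open>q\<close> from \<open>i\<close> to \<open>j\<close>, level \<open>m\<close> consists of the
  indices reachable from \<open>i\<close> in \<open>m\<close> steps that reach \<open>j\<close> in \<open>q - m\<close> steps. If \<open>q \<ge> 4\<close>, these two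
  sets together cover all \<open>2r + 2\<close> indices, so the level sizes follow from the sizes of the two
  sets. Every row of \<open>M\<close> and \<open>M\<^sup>2\<close> has supports of sizes \<open>(r + 2, 2r + 2)\<close> or \<open>(2, r + 2)\<close>, and
  likewise for columns; in both cases \<open>1 - |supp M| + |supp M\<^sup>2|\<close> equals \<open>r + 1\<close>, half the
  number of indices, which makes the alternating sum of the level sizes vanish.
  The lengths \<open>q \<le> 3\<close> are checked directly.\<close>

section \<open>Supports of products and powers of non-negative matrices\<close>

text \<open>Terms of the entry sum are non-negative and cannot cancel, so supports multiply like
  Boolean matrices.\<close>

lemma mult_mat_pos_iff:
  fixes A B :: "real mat"
  assumes A: "A \<in> carrier_mat n n" and B: "B \<in> carrier_mat n n"
    and "nonneg_matrix A" "nonneg_matrix B" and ij: "i < n" "j < n"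
  shows "0 \<le> (A * B) $$ (i, j)"
    and "0 < (A * B) $$ (i, j) \<longleftrightarrow> (\<exists>k<n. 0 < A $$ (i, k) \<and> 0 < B $$ (k, j))"
proof -
  have sum: "(A * B) $$ (i, j) = (\<Sum>k<n. A $$ (i, k) * B $$ (k, j))"
    using A B ij by (auto simp: scalar_prod_def atLeast0LessThan intro!: sum.cong)
  have A0: "0 \<le> A $$ (i, k)" and B0: "0 \<le> B $$ (k, j)" if "k < n" for k
    using that assms by (auto simp: nonneg_matrix_def)
  show "0 \<le> (A * B) $$ (i, j)"
    unfolding sum using A0 B0 by (intro sum_nonneg) auto
  have "0 < (\<Sum>k<n. A $$ (i, k) * B $$ (k, j)) \<longleftrightarrow> (\<exists>k<n. 0 < A $$ (i, k) * B $$ (k, j))"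
  proof
    assume pos: "0 < (\<Sum>k<n. A $$ (i, k) * B $$ (k, j))"
    show "\<exists>k<n. 0 < A $$ (i, k) * B $$ (k, j)"
    proof (rule ccontr)
      assume "\<not> ?thesis"
      then have "(\<Sum>k<n. A $$ (i, k) * B $$ (k, j)) \<le> 0"
        by (intro sum_nonpos) (meson lessThan_iff not_less)
      with pos show False by simp
    qed
  next
    assume "\<exists>k<n. 0 < A $$ (i, k) * B $$ (k, j)"
    then obtain k where "k < n" "0 < A $$ (i, k) * B $$ (k, j)" by blast
    then show "0 < (\<Sum>k<n. A $$ (i, k) * B $$ (k, j))"
      using A0 B0 by (intro sum_pos2[of _ k]) auto
  qed
  also have "\<dots> \<longleftrightarrow> (\<exists>k<n. 0 < A $$ (i, k) \<and> 0 < B $$ (k, j))"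
    using A0 B0 by (metis linorder_not_less mult_pos_pos mult_zero_left mult_zero_right
        order_le_less)
  finally show "0 < (A * B) $$ (i, j) \<longleftrightarrow> (\<exists>k<n. 0 < A $$ (i, k) \<and> 0 < B $$ (k, j))"
    unfolding sum .
qed

lemma nonneg_matrix_pow:
  assumes "X \<in> carrier_mat n n" "nonneg_matrix X"
  shows "nonneg_matrix (X ^\<^sub>m m)"
proof (induction m)
  case 0
  then show ?case by (auto simp: nonneg_matrix_def)
next
  case (Suc m)
  have X: "X ^\<^sub>m m \<in> carrier_mat n n" using assms by auto
  show ?case unfolding nonneg_matrix_def
    using mult_mat_pos_iff(1)[OF X assms(1) Suc assms(2)] assms(1) X by auto
qed

lemma pow_mat_Suc_pos_iff:
  assumes X: "X \<in> carrier_mat n n" "nonneg_matrix X" and ij: "i < n" "j < n"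
  shows "0 < (X ^\<^sub>m Suc m) $$ (i, j) \<longleftrightarrow> (\<exists>k<n. 0 < (X ^\<^sub>m m) $$ (i, k) \<and> 0 < X $$ (k, j))"
  using mult_mat_pos_iff(2)[OF pow_carrier_mat[OF X(1)] X(1) nonneg_matrix_pow[OF X] X(2) ij]
  by simp

lemma all_ones_Bin_iff:
  assumes "X \<in> carrier_mat n n"
  shows "all_ones (Bin X) \<longleftrightarrow> (\<forall>i<n. \<forall>j<n. 0 < X $$ (i, j))"
  using assms by (auto simp: all_ones_def Bin_def split: if_splits)

section \<open>Level posets\<close>

text \<open>Each cover step raises the rank by 1; antisymmetry of the order and finiteness of its
  intervals rest on this.\<close>

lemma level_cover_rtrancl_rank:
  assumes "(x, y) \<in> (level_cover X)\<^sup>*"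
  shows "x = y \<or> snd x < snd y"
  using assms by (induction rule: rtrancl_induct) (auto simp: level_cover_def)

lemma level_cover_subset: "level_cover X \<subseteq> level_carrier X \<times> level_carrier X"
  by (auto simp: level_cover_def level_carrier_def)

lemma finite_level_interval: "finite (poset_interval (level_order X) x y)"
proof (rule finite_subset)
  show "poset_interval (level_order X) x y \<subseteq> {0..<dim_row X} \<times> {snd x..snd y}"
    by (auto simp: poset_interval_def level_order_def level_carrier_def
        dest!: level_cover_rtrancl_rank)
qed auto

lemma ranked_poset_level:
  "ranked_poset (level_carrier X) (level_order X) level_rank"
proof -
  have "partial_order_on (level_carrier X) (level_order X)"
    unfolding partial_order_on_def preorder_on_def
  proof (intro conjI)
    show "refl_on (level_carrier X) (level_order X)"
      by (auto simp: refl_on_def level_order_def)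
    show "trans (level_order X)"
      by (auto simp: trans_def level_order_def)
    show "antisym (level_order X)"
      unfolding antisym_def level_order_def
      by (auto dest!: level_cover_rtrancl_rank)
    show "level_order X \<subseteq> level_carrier X \<times> level_carrier X"
      by (auto simp: level_order_def)
  qed
  moreover have "level_rank y = level_rank x + 1" if "poset_covers (level_order X) x y" for x y
  proof -
    have xy: "(x, y) \<in> (level_cover X)\<^sup>*" "x \<noteq> y" "y \<in> level_carrier X" "x \<in> level_carrier X"
      using that by (auto simp: poset_covers_def level_order_def)
    \<comment> \<open>The first step of a generating chain ends inside the interval from
      \<open>x\<close> to \<open>y\<close>, so a cover of the order is itself a generating
      step.\<close>
    then obtain z where z: "(x, z) \<in> level_cover X" "(z, y) \<in> (level_cover X)\<^sup>*"
      by (meson converse_rtranclE)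
    then have "(x, z) \<in> level_order X" "(z, y) \<in> level_order X"
      using xy level_cover_subset[of X] by (auto simp: level_order_def)
    with that have "z = x \<or> z = y" unfolding poset_covers_def by blast
    with z(1) show ?thesis by (auto simp: level_rank_def level_cover_def)
  qed
  ultimately show ?thesis
    by (simp add: ranked_poset_def finite_level_interval)
qed

text \<open>Chains of \<open>m\<close> cover steps are walks of length \<open>m\<close>, which the
  entries of \<open>X ^\<^sub>m m\<close> count.\<close>

lemma level_order_iff_pow:
  assumes X: "X \<in> carrier_mat n n" and X01: "\<And>i j. i < n \<Longrightarrow> j < n \<Longrightarrow> X $$ (i, j) \<in> {0, 1}"
  shows "((i, s), (j, p)) \<in> level_order X \<longleftrightarrow>
    i < n \<and> j < n \<and> s \<le> p \<and> 0 < (X ^\<^sub>m nat (p - s)) $$ (i, j)"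
proof -
  have nn: "nonneg_matrix X"
    using X X01 by (fastforce simp: nonneg_matrix_def)
  have cov: "((i, s), (j, p)) \<in> level_cover X \<longleftrightarrow> i < n \<and> j < n \<and> p = s + 1 \<and> 0 < X $$ (i, j)"
    for i j s p using X X01[of i j] by (auto simp: level_cover_def)
  \<comment> \<open>The premise \<open>i < n\<close> stays inside the claim because the reflexive
    closure also contains pairs outside the carrier.\<close>
  have sound: "i < n \<longrightarrow> fst y < n \<and> s \<le> snd y \<and> 0 < (X ^\<^sub>m nat (snd y - s)) $$ (i, fst y)"
    if "((i, s), y) \<in> (level_cover X)\<^sup>*" for y
    using that
  proof (induction rule: rtrancl_induct)
    case base
    then show ?case using X by auto
  next
    case (step y z)
    obtain k t where y: "y = (k, t)" by force
    obtain l u where z: "z = (l, u)" by force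
    have kl: "k < n" "l < n" "u = t + 1" "0 < X $$ (k, l)"
      using step(2) by (auto simp: cov y z)
    show ?case
    proof
      assume i: "i < n"
      then have st: "s \<le> t" "0 < (X ^\<^sub>m nat (t - s)) $$ (i, k)" using step.IH y by auto
      have "nat (u - s) = Suc (nat (t - s))" using st kl by auto
      then show "fst z < n \<and> s \<le> snd z \<and> 0 < (X ^\<^sub>m nat (snd z - s)) $$ (i, fst z)"
        using pow_mat_Suc_pos_iff[OF X nn i kl(2)] st kl z by auto
    qed
  qed
  have complete: "((i, s), (j, s + int m)) \<in> (level_cover X)\<^sup>*"
    if "i < n" "j < n" "0 < (X ^\<^sub>m m) $$ (i, j)" for m
    using that
  proof (induction m arbitrary: j)
    case 0
    then show ?case using X by (auto split: if_splits)
  next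
    case (Suc m)
    then obtain k where k: "k < n" "0 < (X ^\<^sub>m m) $$ (i, k)" "0 < X $$ (k, j)"
      using pow_mat_Suc_pos_iff[OF X nn] by blast
    have "((k, s + int m), (j, s + int (Suc m))) \<in> level_cover X"
      using k Suc by (simp add: cov)
    with Suc.IH[OF Suc.prems(1) k(1,2)] show ?case by (rule rtrancl_into_rtrancl)
  qed
  show ?thesis
    using sound[of "(j, p)"] complete[of "nat (p - s)"] X
    by (auto simp: level_order_def level_carrier_def)
qed

text \<open>Summing the sign of the rank over an interval level by level gives, up to the sign of
  the bottom rank, the alternating sum of the level sizes; \<open>m\<close> is the height above the
  bottom.\<close>

lemma eulerian_level_posetI:
  assumes X: "X \<in> carrier_mat n n" and X01: "\<And>i j. i < n \<Longrightarrow> j < n \<Longrightarrow> X $$ (i, j) \<in> {0, 1}"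
    and alt: "\<And>i j q. i < n \<Longrightarrow> j < n \<Longrightarrow> q > 0 \<Longrightarrow> 0 < (X ^\<^sub>m q) $$ (i, j) \<Longrightarrow>
      (\<Sum>m\<le>q. (- 1) ^ m *
        int (card {k. k < n \<and> 0 < (X ^\<^sub>m m) $$ (i, k) \<and> 0 < (X ^\<^sub>m (q - m)) $$ (k, j)})) = 0"
  shows "eulerian_poset (level_carrier X) (level_order X) level_rank"
  unfolding eulerian_poset_def
proof (intro conjI ranked_poset_level allI impI)
  fix x y :: "nat \<times> int"
  obtain i s where x: "x = (i, s)" by force
  obtain j p where y: "y = (j, p)" by force
  assume "(x, y) \<in> level_order X \<and> x \<noteq> y"
  then have xy: "(x, y) \<in> level_order X" "x \<noteq> y" by auto
  have "s < p"
    using level_cover_rtrancl_rank[of x y X] xy x y by (auto simp: level_order_def)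
  define q where "q = nat (p - s)"
  have q: "q > 0" "p = s + int q" using \<open>s < p\<close> by (auto simp: q_def)
  have ij: "i < n" "j < n" "0 < (X ^\<^sub>m q) $$ (i, j)"
    using xy level_order_iff_pow[OF X X01] by (auto simp: x y q_def)
  define L where
    "L m = {k. k < n \<and> 0 < (X ^\<^sub>m m) $$ (i, k) \<and> 0 < (X ^\<^sub>m (q - m)) $$ (k, j)}" for m
  let ?I = "poset_interval (level_order X) x y"
  let ?sgn = "\<lambda>z. if even (level_rank z) then 1 else (- 1 :: int)"
  have bij: "bij_betw (\<lambda>(m, k). (k, s + int m)) (SIGMA m:{..q}. L m) ?I"
  proof (rule bij_betw_imageI)
    show "inj_on (\<lambda>(m, k). (k, s + int m)) (SIGMA m:{..q}. L m)"
      by (auto simp: inj_on_def)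
    show "(\<lambda>(m, k). (k, s + int m)) ` (SIGMA m:{..q}. L m) = ?I"
    proof (intro equalityI subsetI)
      fix z assume "z \<in> (\<lambda>(m, k). (k, s + int m)) ` (SIGMA m:{..q}. L m)"
      then obtain m k where mk: "m \<le> q" "k \<in> L m" "z = (k, s + int m)" by auto
      moreover have "nat (s + int q - (s + int m)) = q - m" using mk by auto
      ultimately show "z \<in> ?I" using ij
        by (auto simp: poset_interval_def x y level_order_iff_pow[OF X X01] L_def q(2))
    next
      fix z assume zI: "z \<in> ?I"
      obtain k t where z: "z = (k, t)" by force
      have kt: "s \<le> t" "t \<le> p" "k < n" "0 < (X ^\<^sub>m nat (t - s)) $$ (i, k)"
        "0 < (X ^\<^sub>m nat (p - t)) $$ (k, j)"
        using zI by (auto simp: poset_interval_def x y z level_order_iff_pow[OF X X01])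
      have "nat (p - t) = q - nat (t - s)" using kt q by auto
      then have "k \<in> L (nat (t - s))" using kt by (simp add: L_def)
      then show "z \<in> (\<lambda>(m, k). (k, s + int m)) ` (SIGMA m:{..q}. L m)"
        using kt q by (intro image_eqI[of _ _ "(nat (t - s), k)"]) (auto simp: z)
    qed
  qed
  have finL: "finite (L m)" for m by (simp add: L_def)
  have "{z \<in> ?I. even (level_rank z)} = ?I \<inter> {z. even (level_rank z)}"
    "{z \<in> ?I. odd (level_rank z)} = ?I \<inter> - {z. even (level_rank z)}" by auto
  then have "int (card {z \<in> ?I. even (level_rank z)}) - int (card {z \<in> ?I. odd (level_rank z)}) =
      (\<Sum>z\<in>?I. ?sgn z)"
    by (simp add: sum.If_cases finite_level_interval)
  also have "\<dots> = (\<Sum>(m, k)\<in>(SIGMA m:{..q}. L m). ?sgn (k, s + int m))"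
    unfolding sum.reindex_bij_betw[OF bij, symmetric] by (rule sum.cong) auto
  also have "\<dots> = (\<Sum>m\<le>q. \<Sum>k\<in>L m. ?sgn (k, s + int m))"
    by (subst sum.Sigma) (auto simp: finL)
  also have "\<dots> = (\<Sum>m\<le>q. ?sgn x * ((- 1) ^ m * int (card (L m))))"
    by (rule sum.cong) (auto simp: level_rank_def x)
  also have "\<dots> = ?sgn x * (\<Sum>m\<le>q. (- 1) ^ m * int (card (L m)))"
    by (simp only: sum_distrib_left)
  also have "\<dots> = 0"
    using alt[OF ij(1,2) q(1) ij(3)] by (simp add: L_def)
  finally show "card {z \<in> ?I. even (level_rank z)} = card {z \<in> ?I. odd (level_rank z)}"
    by simp
qed

section \<open>Powers of the block matrix\<close>

text \<open>The indices \<open>0..r\<close> belong to the upper blocks and \<open>r + 1..2r + 1\<close> to the lower blocks.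
  \<open>step1\<close> and \<open>step2\<close> describe the supports of \<open>M\<close> and \<open>M\<^sup>2\<close> within the index range.\<close>

definition step1 :: "nat \<Rightarrow> nat \<Rightarrow> nat \<Rightarrow> bool" where
  "step1 r i j \<longleftrightarrow> i = 0 \<and> j \<le> r + 1 \<or> 1 \<le> i \<and> i \<le> r \<and> (j = r + i \<or> j = r + 1 + i) \<or>
     r < i \<and> (j \<le> r \<or> j = 2 * r + 1)"

definition step2 :: "nat \<Rightarrow> nat \<Rightarrow> nat \<Rightarrow> bool" where
  "step2 r i j \<longleftrightarrow> i = 0 \<or> r < i \<or> j \<le> r \<or> j = 2 * r + 1"

text \<open>Closed form for the support of the \<open>m\<close>-th power of M; the last branch
  anticipates positivity from the third power on.\<close>

definition reach :: "nat \<Rightarrow> nat \<Rightarrow> nat \<Rightarrow> nat \<Rightarrow> bool" where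
  "reach r m i j \<longleftrightarrow>
     (if m = 0 then i = j else if m = 1 then step1 r i j else if m = 2 then step2 r i j else True)"

lemma block_matrix_index:
  assumes "i < 2 * r + 2" "j < 2 * r + 2"
  shows "block_matrix r $$ (i, j) = (if step1 r i j then 1 else 0)"
  using assms unfolding block_matrix_def antidiag_reflection_block_A
  by (subst index_mat_four_block) (auto simp: block_A_def block_B_def block_J_def step1_def)

lemma nonneg_block_matrix: "nonneg_matrix (block_matrix r)"
  using block_matrix_carrier[of r] by (auto simp: nonneg_matrix_def block_matrix_index)

lemma reach_Suc:
  assumes "i < 2 * r + 2" "j < 2 * r + 2"
  shows "(\<exists>k<2 * r + 2. reach r m i k \<and> step1 r k j) \<longleftrightarrow> reach r (Suc m) i j"
proof -
  consider "m = 0" | "m = 1" | "m = 2" | "m > 2" by linarith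
  then show ?thesis
  proof cases
    case 1
    then show ?thesis using assms by (auto simp: reach_def)
  next
    case 2
    have "\<exists>k<2 * r + 2. step1 r i k \<and> step1 r k j" if s: "step2 r i j"
    proof -
      consider "1 \<le> i" "i \<le> r" "j \<le> r" | "1 \<le> i" "i \<le> r" "j = 2 * r + 1"
        | "i = 0 \<or> r < i" "j \<le> r" | "i = 0 \<or> r < i" "r < j"
        using s unfolding step2_def by linarith
      then show ?thesis
      proof cases
        case 4
        \<comment> \<open>Row \<open>j - r - 1\<close> meets column \<open>j\<close> on the diagonal
          of B, and rows 0 and \<open>> r\<close> reach every upper index in one step.\<close>
        then show ?thesis using assms by (intro exI[of _ "j - r - 1"]) (auto simp: step1_def)
      next
        case 3
        then show ?thesis by (intro exI[of _ 0]) (auto simp: step1_def)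
      \<comment> \<open>The subdiagonal of B leads from \<open>i\<close> to the lower index
        \<open>r + i\<close>, whose successors are exactly \<open>0..r\<close> and
        \<open>2 * r + 1\<close>.\<close>
      qed (use assms in \<open>auto simp: step1_def intro!: exI[of _ "r + i"]\<close>)
    qed
    moreover have "step2 r i j" if "step1 r i k" "step1 r k j" for k
      using that assms by (auto simp: step1_def step2_def)
    ultimately show ?thesis using 2 by (auto simp: reach_def)
  next
    case 3
    \<comment> \<open>Two steps reach every upper index from any \<open>i\<close>, and every column
      has an upper predecessor: 0 or \<open>j - r - 1\<close>.\<close>
    have "\<exists>k<2 * r + 2. step2 r i k \<and> step1 r k j"
    proof (cases "j \<le> r")
      case True
      then show ?thesis by (intro exI[of _ 0]) (auto simp: step1_def step2_def)
    next
      case False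
      then show ?thesis using assms
        by (intro exI[of _ "j - r - 1"]) (auto simp: step1_def step2_def)
    qed
    then show ?thesis using 3 by (auto simp: reach_def)
  next
    case 4
    \<comment> \<open>After an everywhere positive power it suffices that M has no zero
      column.\<close>
    have "\<exists>k<2 * r + 2. step1 r k j"
    proof (cases "j \<le> r")
      case True
      then show ?thesis by (intro exI[of _ 0]) (auto simp: step1_def)
    next
      case False
      then show ?thesis using assms by (intro exI[of _ "j - r - 1"]) (auto simp: step1_def)
    qed
    then show ?thesis using 4 by (auto simp: reach_def)
  qed
qed

lemma block_matrix_pow_pos_iff:
  assumes "i < 2 * r + 2" "j < 2 * r + 2"
  shows "0 < (block_matrix r ^\<^sub>m m) $$ (i, j) \<longleftrightarrow> reach r m i j"
  using assms
proof (induction m arbitrary: j)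
  case 0
  then show ?case using block_matrix_carrier[of r] by (auto simp: reach_def)
next
  case (Suc m)
  have "0 < (block_matrix r ^\<^sub>m Suc m) $$ (i, j) \<longleftrightarrow>
      (\<exists>k<2 * r + 2. reach r m i k \<and> step1 r k j)"
    unfolding pow_mat_Suc_pos_iff[OF block_matrix_carrier nonneg_block_matrix Suc.prems]
    using Suc by (auto simp: block_matrix_index split: if_splits)
  then show ?case using reach_Suc[OF Suc.prems] by simp
qed

section \<open>Sizes of the levels\<close>

definition reach_out :: "nat \<Rightarrow> nat \<Rightarrow> nat \<Rightarrow> nat set" where
  "reach_out r i m = {k. k < 2 * r + 2 \<and> reach r m i k}"

definition reach_in :: "nat \<Rightarrow> nat \<Rightarrow> nat \<Rightarrow> nat set" where
  "reach_in r j m = {k. k < 2 * r + 2 \<and> reach r m k j}"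

lemma finite_reach [simp]: "finite (reach_out r i m)" "finite (reach_in r j m)"
  by (auto simp: reach_out_def reach_in_def)

lemma reach_out_eq:
  assumes "i < 2 * r + 2"
  shows "reach_out r i 0 = {i}"
    and "reach_out r i (Suc 0) =
      (if i = 0 then {..r + 1} else if i \<le> r then {r + i, r + 1 + i} else insert (2 * r + 1) {..r})"
    and "reach_out r i 2 = (if 1 \<le> i \<and> i \<le> r then insert (2 * r + 1) {..r} else {..<2 * r + 2})"
    and "m \<ge> 3 \<Longrightarrow> reach_out r i m = {..<2 * r + 2}"
  using assms by (auto simp: reach_out_def reach_def step1_def step2_def)

text \<open>Since B is its own anti-diagonal reflection, so is M. Columns thus mirror rows under
  \<open>k\<close> to \<open>2 * r + 1 - k\<close>; columns \<open>r + 1..2 * r\<close> correspond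
  to rows \<open>1..r\<close>.\<close>

lemma reach_in_eq:
  assumes "j < 2 * r + 2"
  shows "reach_in r j 0 = {j}"
    and "reach_in r j (Suc 0) =
      (if j \<le> r then insert 0 {r + 1..2 * r + 1}
       else if j \<le> 2 * r then {j - r - 1, j - r} else {r..2 * r + 1})"
    and "reach_in r j 2 =
      (if r < j \<and> j \<le> 2 * r then insert 0 {r + 1..2 * r + 1} else {..<2 * r + 2})"
    and "m \<ge> 3 \<Longrightarrow> reach_in r j m = {..<2 * r + 2}"
  using assms by (auto simp: reach_in_def reach_def step1_def step2_def)

section \<open>Alternating sums of the level sizes\<close>

text \<open>The partial sum at 2 is \<open>c\<close>, and each later term of size
  \<open>2 * c\<close> flips its sign.\<close>

lemma alternating_sum_eventually_constant:
  fixes f :: "nat \<Rightarrow> int"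
  assumes "f 0 - f 1 + f 2 = c" and "\<And>m. m \<ge> 3 \<Longrightarrow> f m = 2 * c" and "q \<ge> 2"
  shows "(\<Sum>m\<le>q. (- 1) ^ m * f m) = (- 1) ^ q * c"
  using \<open>q \<ge> 2\<close>
proof (induction q rule: dec_induct)
  case base
  then show ?case using assms(1) by (simp add: eval_nat_numeral)
next
  case (step q)
  then show ?case using assms(2)[of "Suc q"] by simp
qed

lemma alternating_sum_reach_out:
  assumes "i < 2 * r + 2" "q \<ge> 2"
  shows "(\<Sum>m\<le>q. (- 1) ^ m * int (card (reach_out r i m))) = (- 1) ^ q * (int r + 1)"
  using assms
  by (intro alternating_sum_eventually_constant) (auto simp: reach_out_eq card_insert_if)

lemma alternating_sum_reach_in:
  assumes "j < 2 * r + 2" "q \<ge> 2"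
  shows "(\<Sum>m\<le>q. (- 1) ^ m * int (card (reach_in r j m))) = (- 1) ^ q * (int r + 1)"
  using assms
  by (intro alternating_sum_eventually_constant) (auto simp: reach_in_eq card_insert_if)

lemma alternating_sum_reach_ge_4:
  assumes ij: "i < 2 * r + 2" "j < 2 * r + 2" and q: "q \<ge> 4"
  shows "(\<Sum>m\<le>q. (- 1) ^ m * int (card (reach_out r i m \<inter> reach_in r j (q - m)))) = 0"
proof -
  have cov: "reach_out r i m \<union> reach_in r j (q - m) = {..<2 * r + 2}" if "m \<le> q" for m
  proof -
    consider "m \<ge> 3" | "q - m \<ge> 3" | "m = 2" "q - m = 2" using q \<open>m \<le> q\<close> by linarith
    then show ?thesis
    proof cases
      case 1
      then show ?thesis using ij by (auto simp: reach_out_eq reach_in_def)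
    next
      case 2
      then show ?thesis using ij by (auto simp: reach_in_eq reach_out_def)
    next
      case 3
      \<comment> \<open>Two steps from \<open>i\<close> reach at least all upper indices, and at
        least all lower indices reach \<open>j\<close> in two steps.\<close>
      then show ?thesis using ij by (auto simp: reach_in_eq reach_out_eq)
    qed
  qed
  \<comment> \<open>Inclusion-exclusion, the union having \<open>2 * r + 2\<close> elements.\<close>
  have card: "int (card (reach_out r i m \<inter> reach_in r j (q - m))) =
      int (card (reach_out r i m)) + int (card (reach_in r j (q - m))) - 2 * (int r + 1)"
    if "m \<le> q" for m
    using card_Un_Int[of "reach_out r i m" "reach_in r j (q - m)"] cov[OF that] by simp
  have "(\<Sum>m\<le>q. (- 1) ^ m * int (card (reach_out r i m \<inter> reach_in r j (q - m)))) =
      (\<Sum>m\<le>q. (- 1) ^ m * int (card (reach_out r i m))) +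
      (\<Sum>m\<le>q. (- 1) ^ m * int (card (reach_in r j (q - m)))) -
      2 * (int r + 1) * (\<Sum>m\<le>q. (- 1) ^ m)"
    by (simp add: card algebra_simps sum.distrib sum_subtractf sum_distrib_left)
  also have "(\<Sum>m\<le>q. (- 1) ^ m * int (card (reach_in r j (q - m)))) =
      (\<Sum>m\<le>q. (- 1) ^ (q - m) * int (card (reach_in r j m)))"
    by (rule sum.reindex_bij_witness[of _ "\<lambda>m. q - m" "\<lambda>m. q - m"]) auto
  also have "\<dots> = (- 1) ^ q * (\<Sum>m\<le>q. (- 1) ^ m * int (card (reach_in r j m)))"
    unfolding sum_distrib_left
    by (rule sum.cong) (auto simp: minus_one_power_iff)
  also have "(\<Sum>m\<le>q. (- 1) ^ m) = (if even q then 1 else 0 :: int)"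
    by (induction q) auto
  \<comment> \<open>For even \<open>q\<close> the three terms are \<open>r + 1\<close>,
    \<open>r + 1\<close> and \<open>- 2 * (r + 1)\<close>; for odd \<open>q\<close> they are
    \<open>- (r + 1)\<close>, \<open>r + 1\<close> and 0.\<close>
  finally show ?thesis
    using ij q by (simp add: alternating_sum_reach_out alternating_sum_reach_in)
qed

lemma alternating_sum_reach:
  assumes ij: "i < 2 * r + 2" "j < 2 * r + 2" and q: "q > 0" and "reach r q i j"
  shows "(\<Sum>m\<le>q. (- 1) ^ m * int (card (reach_out r i m \<inter> reach_in r j (q - m)))) = 0"
proof -
  have ends: "reach_out r i 0 \<inter> reach_in r j q = {i}" "reach_out r i q \<inter> reach_in r j 0 = {j}"
    using ij \<open>reach r q i j\<close> by (auto simp: reach_out_def reach_in_def reach_def)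
  consider "q = 1" | "q = 2" | "q = 3" | "q \<ge> 4" using q by linarith
  then show ?thesis
  proof cases
    case 1
    then show ?thesis using ends by simp
  next
    case 2
    have "step2 r i j" using 2 \<open>reach r q i j\<close> by (simp add: reach_def)
    \<comment> \<open>Length 2 requires a middle level of two elements. If
      \<open>1 \<le> i \<le> r\<close>, then \<open>step2\<close> excludes
      \<open>r < j \<le> 2 * r\<close>, so both successors of \<open>i\<close>, being lower indices,
      precede \<open>j\<close>.\<close>
    have "reach_out r i 1 \<inter> reach_in r j 1 =
        (if 1 \<le> i \<and> i \<le> r then {r + i, r + 1 + i}
         else if j \<le> r then {0, if i = 0 then r + 1 else 2 * r + 1}
         else if j \<le> 2 * r then {j - r - 1, j - r}
         else {r, if i = 0 then r + 1 else 2 * r + 1})"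
      using ij \<open>step2 r i j\<close> by (auto simp: reach_out_eq reach_in_eq step2_def)
    then have "card (reach_out r i 1 \<inter> reach_in r j 1) = 2" by (auto simp: card_insert_if)
    then show ?thesis using ends 2 by (simp add: eval_nat_numeral)
  next
    case 3
    \<comment> \<open>Length 3 requires middle levels of equal size: 2 if
      \<open>1 \<le> i \<le> r\<close> or \<open>r < j \<le> 2 * r\<close>, and \<open>r + 2\<close>
      otherwise.\<close>
    have "reach_out r i 1 \<inter> reach_in r j 2 =
        (if r < j \<and> j \<le> 2 * r \<and> \<not> (1 \<le> i \<and> i \<le> r)
         then {0, if i = 0 then r + 1 else 2 * r + 1} else reach_out r i 1)"
      using ij by (auto simp: reach_out_eq reach_in_eq)
    moreover have "reach_out r i 2 \<inter> reach_in r j 1 =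
        (if 1 \<le> i \<and> i \<le> r \<and> \<not> (r < j \<and> j \<le> 2 * r)
         then {if j \<le> r then 0 else r, 2 * r + 1} else reach_in r j 1)"
      using ij by (auto simp: reach_out_eq reach_in_eq)
    ultimately have "card (reach_out r i 1 \<inter> reach_in r j 2) =
        card (reach_out r i 2 \<inter> reach_in r j 1)"
      using ij by (auto simp: reach_out_eq reach_in_eq card_insert_if)
    then show ?thesis using ends 3 by (simp add: eval_nat_numeral)
  next
    case 4
    then show ?thesis using alternating_sum_reach_ge_4[OF ij] by blast
  qed
qed

theorem proposition4p2:
  fixes r :: nat
  assumes "r \<ge> 1"
  shows "primitive_matrix (block_matrix r) \<and>
    matrix_exponent (block_matrix r) = 3 \<and>
    eulerian_poset (level_carrier (block_matrix r)) (level_order (block_matrix r)) level_rank"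
proof -
  let ?M = "block_matrix r"
  note M = block_matrix_carrier[of r]
  have ones: "all_ones (Bin (?M ^\<^sub>m k)) \<longleftrightarrow> (\<forall>i<2 * r + 2. \<forall>j<2 * r + 2. reach r k i j)" for k
    using all_ones_Bin_iff[OF pow_carrier_mat[OF M]] block_matrix_pow_pos_iff by auto
  have three: "all_ones (Bin (?M ^\<^sub>m 3))"
    by (simp add: ones reach_def)
  \<comment> \<open>Zero entries of M and its square in row 1, an upper row other than row 0 because
    \<open>r \<ge> 1\<close>. For \<open>r = 0\<close> all entries of M are 1 and the exponent is
    1.\<close>
  have "\<not> reach r 1 1 0" "\<not> reach r 2 1 (r + 1)"
    using assms by (auto simp: reach_def step1_def step2_def)
  with assms have less: "3 \<le> k" if "k > 0" "all_ones (Bin (?M ^\<^sub>m k))" for k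
    using that unfolding ones
    by (cases "k = 1"; cases "k = 2") force+
  have "primitive_matrix ?M"
    using M nonneg_block_matrix three by (auto simp: primitive_matrix_def intro!: exI[of _ 3])
  moreover have "matrix_exponent ?M = 3"
    unfolding matrix_exponent_def using three less by (intro Least_equality) auto
  moreover have "eulerian_poset (level_carrier ?M) (level_order ?M) level_rank"
  proof (rule eulerian_level_posetI[OF M])
    fix i j q assume ij: "i < 2 * r + 2" "j < 2 * r + 2" and q: "q > 0"
      and pos: "0 < (?M ^\<^sub>m q) $$ (i, j)"
    have "{k. k < 2 * r + 2 \<and> 0 < (?M ^\<^sub>m m) $$ (i, k) \<and> 0 < (?M ^\<^sub>m (q - m)) $$ (k, j)} =
        reach_out r i m \<inter> reach_in r j (q - m)" for m
      using ij by (auto simp: reach_out_def reach_in_def block_matrix_pow_pos_iff)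
    then show "(\<Sum>m\<le>q. (- 1) ^ m * int (card {k. k < 2 * r + 2 \<and>
        0 < (?M ^\<^sub>m m) $$ (i, k) \<and> 0 < (?M ^\<^sub>m (q - m)) $$ (k, j)})) = 0"
      using alternating_sum_reach[OF ij q] pos ij by (simp add: block_matrix_pow_pos_iff)
  qed (auto simp: block_matrix_index)
  ultimately show ?thesis by blast
qed

end
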